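(* Let $u\in U$ be the solution of the continuous problem: $a(u,v)=l(v)$ for all $v\in V$. Let $u_\theta\in U_{NN}$ be a neural network function with trainable parameters $\theta\in\mathbb{R}^S$, let $V_M\subseteq V$ be a finite-dimensional subspace with norm $\|\cdot\|_V$, and let $\phi=\phi(\theta)\in V_M$ be the solution of $$(\phi,v_M)_V = l(v_M)-a(u_\theta,v_M)\quad\text{for all } v_M\in V_M .$$ Then $$\frac{1}{\mu}\,\|\phi\|_V \;\le\; \|[u-u_\theta]\|_{U/U_M^0}\;\le\;\frac{1}{\alpha}\,\|\phi\|_V .$$
   Context: $U$ and $V$ are (real) Hilbert spaces with norms $\|\cdot\|_U$, $\|\cdot\|_V$; $(\cdot,\cdot)_V$ is the inner product of $V$, with $\|v\|_V^2=(v,v)_V$. $l\in V'$ is a bounded linear functional and $a:U\times V\to\mathbb{R}$ is a bilinear form for which there are constants $\mu,\alpha>0$ such that - $a(w,v)\le \mu\|w\|_U\|v\|_V$ for all $w\in U$, $v\in V$; - $\sup_{0\ne v\in V} a(w,v)/\|v\|_V\ge \alpha\|w\|_U$ for all $w\in U$; - for $v\in V$: if $a(w,v)=0$ for all $w\in U$, then $v=0$. Under these assumptions the continuous problem has a unique solution $u$. Neural networks: the elements of $U$ are functions of $\mathbf{x}=(x_1,\dots,x_d)$. For a fixed fully-connected feedforward architecture with $L$ layers and nonlinear activation $\sigma$, the parameter vector $\theta\in\mathbb{R}^S$ collects all weights $\mathbf{w}^{(l)}$ and biases $\mathbf{b}^{(l)}$, and $u_\theta(\mathbf{x})=\mathbf{w}^{(L)}\mathbf{z}^{(L-1)}+\mathbf{b}^{(L)}$,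 where $\mathbf{z}^{(0)}=\mathbf{x}$ and $\mathbf{z}^{(l)}=\sigma(\mathbf{w}^{(l)}\mathbf{z}^{(l-1)}+\mathbf{b}^{(l)})$ for $l=1,\dots,L-1$. $U_{NN}:=\{u_\theta:\theta\in\mathbb{R}^S\}\cap U$, assumed nonempty. $U_M^0:=\{w\in U: a(w,v_M)=0\ \text{for all } v_M\in V_M\}$, and on the quotient space $U/U_M^0$ the norm is $\|[w]\|_{U/U_M^0}:=\inf_{w_0\in U_M^0}\|w+w_0\|_U$. *)

theory Defs
  imports "HOL-Analysis.Analysis"
begin

text \<open>
  A real Hilbert space is a type of class \<^class>\<open>real_inner\<close> and \<^class>\<open>complete_space\<close>.
  In a Hilbert space of functions such as an L2 or a Sobolev space, the elements are functions
  on a domain up to equality almost everywhere. Such a space is given here by a Hilbert space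
  \<open>'u\<close>, a linear space \<open>F\<close> of functions and a linear surjection \<open>cls\<close> that sends each function
  in \<open>F\<close> to the element of \<open>'u\<close> that it represents; two functions represent the same element iff
  they agree \<open>M\<close>-almost everywhere. For a domain \<open>D\<close>, the choice \<open>M = lebesgue_on D\<close> gives
  equality almost everywhere on \<open>D\<close>, and \<open>M = count_space D\<close> gives genuine functions on \<open>D\<close>.
  The representatives are total functions, whose values outside the space of \<open>M\<close> are irrelevant.
\<close>

locale hilbert_function_space =
  fixes M :: "'x::euclidean_space measure"
    and F :: "('x \<Rightarrow> 'y::euclidean_space) set"
    and cls :: "('x \<Rightarrow> 'y) \<Rightarrow> 'u::{real_inner, complete_space}"
  assumes add_mem: "f \<in> F \<Longrightarrow> g \<in> F \<Longrightarrow> (\<lambda>x. f x + g x) \<in> F"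
    and scaleR_mem: "f \<in> F \<Longrightarrow> (\<lambda>x. c *\<^sub>R f x) \<in> F"
    and AE_mem: "f \<in> F \<Longrightarrow> (AE x in M. f x = g x) \<Longrightarrow> g \<in> F"
    and cls_add: "f \<in> F \<Longrightarrow> g \<in> F \<Longrightarrow> cls (\<lambda>x. f x + g x) = cls f + cls g"
    and cls_scaleR: "f \<in> F \<Longrightarrow> cls (\<lambda>x. c *\<^sub>R f x) = c *\<^sub>R cls f"
    and cls_eq_iff: "f \<in> F \<Longrightarrow> g \<in> F \<Longrightarrow> cls f = cls g \<longleftrightarrow> (AE x in M. f x = g x)"
    and cls_surj: "cls ` F = UNIV"

text \<open>
  Euclidean spaces \<open>'x\<close>, \<open>'y\<close>, \<open>'s\<close> play the role of the coordinate spaces for the input, the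
  output and the parameters. Their coordinates are numbered from 0 by an arbitrary but fixed
  enumeration of the standard basis.
\<close>

definition coord :: "'a::euclidean_space \<Rightarrow> nat \<Rightarrow> real" where
  "coord x i = x \<bullet> from_nat_into Basis i"

text \<open>
  Layer \<open>l\<close> (for \<open>1 \<le> l \<le> L\<close>) has \<open>n l\<close> neurons, and \<open>n 0\<close> is the input dimension. The
  parameter vector is laid out layer by layer, and within a layer neuron by neuron: the
  \<open>n (l - 1)\<close> weights of a neuron are followed by its bias.
\<close>

definition layer_offset :: "(nat \<Rightarrow> nat) \<Rightarrow> nat \<Rightarrow> nat" where
  "layer_offset n l = (\<Sum>k = 1..<l. n k * (n (k - 1) + 1))"

definition num_params :: "(nat \<Rightarrow> nat) \<Rightarrow> nat \<Rightarrow> nat" where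
  "num_params n L = (\<Sum>k = 1..L. n k * (n (k - 1) + 1))"

definition weight :: "(nat \<Rightarrow> nat) \<Rightarrow> 's::euclidean_space \<Rightarrow> nat \<Rightarrow> nat \<Rightarrow> nat \<Rightarrow> real" where
  "weight n \<theta> l i j = coord \<theta> (layer_offset n l + i * (n (l - 1) + 1) + j)"

definition bias :: "(nat \<Rightarrow> nat) \<Rightarrow> 's::euclidean_space \<Rightarrow> nat \<Rightarrow> nat \<Rightarrow> real" where
  "bias n \<theta> l i = coord \<theta> (layer_offset n l + i * (n (l - 1) + 1) + n (l - 1))"

definition affine_layer ::
    "(nat \<Rightarrow> nat) \<Rightarrow> 's::euclidean_space \<Rightarrow> nat \<Rightarrow> (nat \<Rightarrow> real) \<Rightarrow> nat \<Rightarrow> real" where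
  "affine_layer n \<theta> l z i = (\<Sum>j<n (l - 1). weight n \<theta> l i j * z j) + bias n \<theta> l i"

primrec hidden_layer ::
    "(real \<Rightarrow> real) \<Rightarrow> (nat \<Rightarrow> nat) \<Rightarrow> 's::euclidean_space \<Rightarrow> 'x::euclidean_space \<Rightarrow> nat \<Rightarrow> nat \<Rightarrow> real"
  where
  "hidden_layer \<sigma> n \<theta> x 0 = coord x"
| "hidden_layer \<sigma> n \<theta> x (Suc l) =
     (\<lambda>i. \<sigma> (affine_layer n \<theta> (Suc l) (hidden_layer \<sigma> n \<theta> x l) i))"

definition network ::
    "(real \<Rightarrow> real) \<Rightarrow> (nat \<Rightarrow> nat) \<Rightarrow> nat \<Rightarrow> 's::euclidean_space \<Rightarrow>
      'x::euclidean_space \<Rightarrow> 'y::euclidean_space" where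
  "network \<sigma> n L \<theta> x =
     (\<Sum>i<n L. affine_layer n \<theta> L (hidden_layer \<sigma> n \<theta> x (L - 1)) i *\<^sub>R from_nat_into Basis i)"

text \<open>
  The parameters range over the whole type \<open>'s\<close>, which is passed explicitly because it does not
  occur in the type of the result.
\<close>

definition network_space ::
    "'s::euclidean_space itself \<Rightarrow> (real \<Rightarrow> real) \<Rightarrow> (nat \<Rightarrow> nat) \<Rightarrow> nat \<Rightarrow>
      ('x::euclidean_space \<Rightarrow> 'y::euclidean_space) set \<Rightarrow> ('x \<Rightarrow> 'y) set" where
  "network_space TYPE('s) \<sigma> n L F = {network \<sigma> n L \<theta> | \<theta> :: 's. True} \<inter> F"

definition left_annihilator :: "('u \<Rightarrow> 'v \<Rightarrow> real) \<Rightarrow> 'v set \<Rightarrow> 'u set" where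
  "left_annihilator a VM = {w. \<forall>v\<in>VM. a w v = 0}"

text \<open>
  The elements of the quotient by a subspace \<open>N\<close> are the cosets of \<open>N\<close>. The norm below, applied to
  the coset of \<open>w\<close>, is the infimum of \<open>norm (w + w0)\<close> over all \<open>w0 \<in> N\<close>.
\<close>

definition coset_of :: "'u::real_normed_vector set \<Rightarrow> 'u \<Rightarrow> 'u set" where
  "coset_of N w = {w + w0 | w0. w0 \<in> N}"

definition quotient_norm :: "'u::real_normed_vector set \<Rightarrow> real" where
  "quotient_norm C = (INF w\<in>C. norm w)"

lemma quotient_norm_coset_of: "quotient_norm (coset_of N w) = (INF w0\<in>N. norm (w + w0))"
  by (simp add: quotient_norm_def coset_of_def Setcompr_eq_image image_image)

end

theory Submission
  imports Defs
begin

text \<open>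
  On \<open>VM\<close> the residual \<open>\<phi>\<close> represents \<open>a (u - cls u\<theta>)\<close>. Testing with \<open>\<phi>\<close> itself and using the
  continuity of \<open>a\<close> gives the lower bound. For the upper bound, the hypotheses on \<open>a\<close> make the
  operator \<open>A\<close> with \<open>A w \<bullet> v = a w v\<close> an isomorphism with \<open>\<alpha> * norm w \<le> norm (A w)\<close> (the
  Babuska-Lax-Milgram theorem), and the solution \<open>w\<close> of \<open>A w = \<phi>\<close> lies in the coset of \<open>u - cls u\<theta>\<close>
  because both define the same functional on \<open>VM\<close>.
\<close>

text \<open>A minimizing sequence is Cauchy by the parallelogram law. Completeness gives it a limit,
  closedness keeps the limit in \<open>S\<close>, and continuity of the norm makes it a
  minimizer.\<close>

lemma nearest_point_subspace:
  fixes S :: "'a::{real_inner, complete_space} set" and x :: 'a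
  assumes S: "subspace S" and "closed S"
  obtains p where "p \<in> S" and "\<And>y. y \<in> S \<Longrightarrow> norm (x - p) \<le> norm (x - y)"
proof -
  define d where "d = (INF y\<in>S. norm (x - y))"
  have ne: "S \<noteq> {}" using subspace_0[OF S] by auto
  have bdd: "bdd_below ((\<lambda>y. norm (x - y)) ` S)" by (rule bdd_belowI[of _ 0]) auto
  have d_le: "d \<le> norm (x - y)" if "y \<in> S" for y
    unfolding d_def by (rule cINF_lower[OF bdd that])
  have d_ge: "0 \<le> d" unfolding d_def by (rule cINF_greatest[OF ne]) simp
  \<comment> \<open>The slack is attached to the squared distance, so that the parallelogram
    identity below yields a bound free of \<open>d\<close>.\<close>
  have "\<exists>y\<in>S. (norm (x - y))\<^sup>2 < d\<^sup>2 + inverse (real (Suc k))" for k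
  proof -
    have "sqrt (d\<^sup>2) < sqrt (d\<^sup>2 + inverse (real (Suc k)))"
      by (rule real_sqrt_less_mono) simp
    then have "d < sqrt (d\<^sup>2 + inverse (real (Suc k)))" using d_ge by simp
    then obtain y where y: "y \<in> S" "norm (x - y) < sqrt (d\<^sup>2 + inverse (real (Suc k)))"
      unfolding d_def using cINF_less_iff[OF ne bdd] by blast
    have "(norm (x - y))\<^sup>2 < (sqrt (d\<^sup>2 + inverse (real (Suc k))))\<^sup>2"
      using y(2) by (intro power_strict_mono) auto
    also have "\<dots> = d\<^sup>2 + inverse (real (Suc k))" by (rule real_sqrt_pow2) simp
    finally show ?thesis using y(1) by blast
  qed
  then obtain Y where Y: "\<And>k. Y k \<in> S"
    and Y_lt: "\<And>k. (norm (x - Y k))\<^sup>2 < d\<^sup>2 + inverse (real (Suc k))"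
    by metis
  \<comment> \<open>Parallelogram identity for \<open>x - Y i\<close> and \<open>x - Y j\<close>:
    the midpoint \<open>m\<close> lies in \<open>S\<close>, hence at distance at least
    \<open>d\<close> from \<open>x\<close>, and the terms in \<open>d\<close> cancel.\<close>
  have gap: "(dist (Y i) (Y j))\<^sup>2 < 2 * inverse (real (Suc i)) + 2 * inverse (real (Suc j))" for i j
  proof -
    define m where "m = (1 / 2) *\<^sub>R (Y i + Y j)"
    have "m \<in> S" unfolding m_def by (intro subspace_scale[OF S] subspace_add[OF S] Y)
    then have "d\<^sup>2 \<le> (norm (x - m))\<^sup>2" using d_le d_ge by (simp add: power_mono)
    moreover have "(dist (Y i) (Y j))\<^sup>2 =
        2 * (norm (x - Y i))\<^sup>2 + 2 * (norm (x - Y j))\<^sup>2 - 4 * (norm (x - m))\<^sup>2"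
      unfolding dist_norm power2_norm_eq_inner m_def
      by (simp add: inner_simps inner_commute field_simps)
    ultimately show ?thesis using Y_lt[of i] Y_lt[of j] by linarith
  qed
  have "Cauchy Y"
  proof (rule metric_CauchyI)
    fix e :: real
    assume e: "0 < e"
    then obtain N where N: "inverse (real (Suc N)) < e\<^sup>2 / 4"
      using reals_Archimedean[of "e\<^sup>2 / 4"] by auto
    have "dist (Y i) (Y j) < e" if "N \<le> i" "N \<le> j" for i j
    proof -
      have "inverse (real (Suc i)) \<le> inverse (real (Suc N))"
        and "inverse (real (Suc j)) \<le> inverse (real (Suc N))"
        using that by (auto intro!: le_imp_inverse_le)
      then have "(dist (Y i) (Y j))\<^sup>2 < e\<^sup>2" using gap[of i j] N by linarith
      then show ?thesis using e by (auto intro: power_less_imp_less_base)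
    qed
    then show "\<exists>N. \<forall>i\<ge>N. \<forall>j\<ge>N. dist (Y i) (Y j) < e" by blast
  qed
  then obtain p where p: "Y \<longlonglongrightarrow> p" using Cauchy_convergent convergent_def by blast
  have "p \<in> S" using closed_sequentially[OF \<open>closed S\<close>] Y p by blast
  have "(\<lambda>k. d\<^sup>2 + inverse (real (Suc k))) \<longlonglongrightarrow> d\<^sup>2 + 0"
    by (intro tendsto_intros LIMSEQ_inverse_real_of_nat)
  moreover have "(\<lambda>k. (norm (x - Y k))\<^sup>2) \<longlonglongrightarrow> (norm (x - p))\<^sup>2"
    by (intro tendsto_intros p)
  ultimately have "(norm (x - p))\<^sup>2 \<le> d\<^sup>2 + 0"
    using Y_lt by (intro LIMSEQ_le[where X = "\<lambda>k. (norm (x - Y k))\<^sup>2"]) (auto intro: less_imp_le)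
  then have "norm (x - p) \<le> d" using d_ge by (auto intro: power2_le_imp_le)
  then show thesis using that[OF \<open>p \<in> S\<close>] d_le by (meson order_trans)
qed

text \<open>Moving the nearest point inside \<open>S\<close> along \<open>y\<close> cannot reduce
  the distance, which forces the first-order term to vanish.\<close>

lemma orthogonal_projection_exists:
  fixes S :: "'a::{real_inner, complete_space} set" and x :: 'a
  assumes S: "subspace S" and "closed S"
  obtains p where "p \<in> S" and "\<And>y. y \<in> S \<Longrightarrow> (x - p) \<bullet> y = 0"
proof -
  obtain p where p: "p \<in> S" and min: "\<And>y. y \<in> S \<Longrightarrow> norm (x - p) \<le> norm (x - y)"
    using nearest_point_subspace[OF assms, where x = x] by blast
  have "(x - p) \<bullet> y = 0" if y: "y \<in> S" for y
  proof (cases "y = 0")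
    case False
    define r where "r = x - p"
    \<comment> \<open>The minimizer of the quadratic \<open>norm (r - t *\<^sub>R y)\<close> squared
      in \<open>t\<close>; it lowers the square by
      \<open>(r \<bullet> y)\<^sup>2 / (y \<bullet> y)\<close>.\<close>
    define t where "t = (r \<bullet> y) / (y \<bullet> y)"
    have yy: "0 < y \<bullet> y" using False by simp
    have "p + t *\<^sub>R y \<in> S" by (intro subspace_add[OF S] subspace_scale[OF S] p y)
    then have "norm r \<le> norm (r - t *\<^sub>R y)" using min unfolding r_def by (metis diff_diff_add)
    then have "r \<bullet> r \<le> (r - t *\<^sub>R y) \<bullet> (r - t *\<^sub>R y)" by (simp add: norm_le)
    also have "\<dots> = r \<bullet> r - 2 * t * (r \<bullet> y) + t * t * (y \<bullet> y)"
      by (simp add: inner_simps inner_commute algebra_simps)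
    also have "t * t * (y \<bullet> y) = t * (r \<bullet> y)" using yy by (simp add: t_def)
    finally have "t * (r \<bullet> y) \<le> 0" by linarith
    then have "(r \<bullet> y)\<^sup>2 / (y \<bullet> y) \<le> 0" by (simp add: t_def power2_eq_square)
    then have "(r \<bullet> y)\<^sup>2 \<le> 0" using yy by (simp add: divide_le_0_iff)
    then show ?thesis unfolding r_def by simp
  qed simp
  then show thesis using that p by blast
qed

text \<open>The kernel of a nonzero \<open>f\<close> is closed and has codimension one, so a nonzero
  vector \<open>z\<close> orthogonal to it determines \<open>f\<close> up to a scalar.\<close>

lemma riesz_representation:
  fixes f :: "'a::{real_inner, complete_space} \<Rightarrow> real"
  assumes f: "bounded_linear f"
  obtains r where "\<And>v. f v = r \<bullet> v"
proof (cases "\<forall>v. f v = 0")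
  case True
  then show thesis using that[of 0] by simp
next
  case False
  then obtain x where x: "f x \<noteq> 0" by blast
  interpret f: bounded_linear f by (rule f)
  define K where "K = {v. f v = 0}"
  have "subspace K" unfolding K_def subspace_def by (simp add: f.zero f.add f.scaleR)
  moreover have "closed K"
    unfolding K_def by (intro closed_Collect_eq continuous_intros f.continuous_on)
  ultimately obtain p where p: "p \<in> K" and orth: "\<And>y. y \<in> K \<Longrightarrow> (x - p) \<bullet> y = 0"
    using orthogonal_projection_exists[where x = x] by blast
  define z where "z = x - p"
  have fz: "f z \<noteq> 0" using x p by (simp add: z_def K_def f.diff)
  then have zz: "z \<bullet> z \<noteq> 0" using f.zero by auto
  have "f v = ((f z / (z \<bullet> z)) *\<^sub>R z) \<bullet> v" for v
  proof -
    \<comment> \<open>Removing the multiple of \<open>z\<close> on which \<open>f\<close> takes the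
      value \<open>f v\<close> leaves a vector of the kernel.\<close>
    have "v - (f v / f z) *\<^sub>R z \<in> K" using fz by (simp add: K_def f.diff f.scaleR)
    then have "z \<bullet> (v - (f v / f z) *\<^sub>R z) = 0" unfolding z_def by (rule orth)
    then have "z \<bullet> v = f v / f z * (z \<bullet> z)" by (simp add: inner_simps)
    then show ?thesis using fz zz by simp
  qed
  then show thesis using that by blast
qed

text \<open>The lower bound makes preimages of a Cauchy sequence in the range Cauchy, so
  completeness passes from the domain to the range.\<close>

lemma closed_range_bounded_below:
  fixes A :: "'a::{real_normed_vector, complete_space} \<Rightarrow> 'b::real_normed_vector"
  assumes A: "bounded_linear A" and "\<alpha> > 0" and below: "\<And>w. \<alpha> * norm w \<le> norm (A w)"
  shows "closed (range A)"
proof -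
  interpret A: bounded_linear A by (rule A)
  have "complete (range A)"
    by (rule complete_isometric_image[OF \<open>\<alpha> > 0\<close> subspace_UNIV A])
      (use below in \<open>auto simp: complete_UNIV mult.commute\<close>)
  then show ?thesis by (rule complete_imp_closed)
qed

text \<open>Surjectivity of \<open>A\<close> splits in two: the inf-sup condition closes the range,
  and nondegeneracy leaves nothing orthogonal to it.\<close>

lemma babuska_lax_milgram:
  fixes a :: "'u::{real_inner, complete_space} \<Rightarrow> 'v::{real_inner, complete_space} \<Rightarrow> real"
  assumes bil: "bilinear a"
    and "\<mu> > 0" and "\<alpha> > 0"
    and bound: "\<And>w v. a w v \<le> \<mu> * norm w * norm v"
    and infsup: "\<And>w. (SUP v\<in>{v. v \<noteq> 0}. a w v / norm v) \<ge> \<alpha> * norm w"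
    and nondeg: "\<And>v. (\<And>w. a w v = 0) \<Longrightarrow> v = 0"
  obtains w where "\<And>v. a w v = \<phi> \<bullet> v" and "\<alpha> * norm w \<le> norm \<phi>"
proof -
  have lin: "linear (a w)" "linear (\<lambda>w. a w v)" for w v
    using bil unfolding bilinear_def by auto
  \<comment> \<open>The assumed bound is one-sided; applying it to \<open>- v\<close> as well bounds
    the absolute value.\<close>
  have abs_bound: "\<bar>a w v\<bar> \<le> \<mu> * norm w * norm v" for w v
    using bound[of w v] bound[of w "- v"] by (simp add: linear_neg[OF lin(1)] abs_le_iff)
  have "bounded_linear (a w)" for w
    by (rule bounded_linear_intro[where K = "\<mu> * norm w"])
      (use abs_bound in \<open>auto simp: linear_add[OF lin(1)] linear_scale[OF lin(1)] mult_ac\<close>)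
  then have "\<exists>r. \<forall>v. a w v = r \<bullet> v" for w
    using riesz_representation by metis
  then obtain A where A: "\<And>w v. a w v = A w \<bullet> v" by metis
  have A_bl: "bounded_linear A"
  proof (rule bounded_linear_intro[where K = \<mu>])
    show "A (w + w') = A w + A w'" for w w'
      by (rule vector_eq_rdot[THEN iffD1])
        (simp add: inner_simps flip: A, simp add: linear_add[OF lin(2)])
    show "A (c *\<^sub>R w) = c *\<^sub>R A w" for c w
      by (rule vector_eq_rdot[THEN iffD1])
        (simp add: inner_simps flip: A, simp add: linear_scale[OF lin(2)])
    show "norm (A w) \<le> norm w * \<mu>" for w
    proof (cases "A w = 0")
      case False
      have "norm (A w) * norm (A w) \<le> (\<mu> * norm w) * norm (A w)"
        using bound[of w "A w"] by (simp add: A flip: power2_norm_eq_inner power2_eq_square)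
      then show ?thesis using False by (simp add: mult.commute)
    qed (use \<open>\<mu> > 0\<close> in simp)
  qed
  interpret A: bounded_linear A by (rule A_bl)
  have below: "\<alpha> * norm w \<le> norm (A w)" for w
  proof (cases "\<exists>v::'v. v \<noteq> 0")
    case True
    \<comment> \<open>Each quotient is at most \<open>norm (A w)\<close> by Cauchy-Schwarz; a
      nonzero \<open>v\<close> keeps the index set nonempty.\<close>
    have "(SUP v\<in>{v. v \<noteq> 0}. a w v / norm v) \<le> norm (A w)"
      using True by (intro cSUP_least) (auto simp: A divide_simps norm_cauchy_schwarz)
    then show ?thesis using infsup[of w] by linarith
  next
    \<comment> \<open>The supremum is over the empty set, so its value is an unspecified constant; since it
      bounds \<open>\<alpha> * norm w\<close> for all \<open>w\<close>, the space \<open>'u\<close> is trivial as well.\<close>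
    case False
    define c where "c = Sup ({} :: real set)"
    have c: "\<alpha> * norm w' \<le> c" for w' :: 'u
      using infsup[of w'] False by (simp add: c_def)
    have "w = 0"
    proof (rule ccontr)
      assume w: "w \<noteq> 0"
      define s where "s = (\<bar>c\<bar> + 1) / (\<alpha> * norm w)"
      have "\<alpha> * norm (s *\<^sub>R w) = \<bar>c\<bar> + 1" using w \<open>\<alpha> > 0\<close> by (simp add: s_def)
      then show False using c[of "s *\<^sub>R w"] by linarith
    qed
    then show ?thesis by simp
  qed
  have "subspace (range A)" by (intro linear_subspace_image A.linear subspace_UNIV)
  then obtain p where p: "p \<in> range A" and orth: "\<And>y. y \<in> range A \<Longrightarrow> (\<phi> - p) \<bullet> y = 0"
    using orthogonal_projection_exists closed_range_bounded_below[OF A_bl \<open>\<alpha> > 0\<close> below] by blast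
  \<comment> \<open>Orthogonality to the range says \<open>a w (\<phi> - p) = 0\<close> for all
    \<open>w\<close>.\<close>
  have "\<phi> - p = 0" by (rule nondeg) (metis A inner_commute orth rangeI)
  then obtain w where "A w = \<phi>" using p by auto
  then show thesis using that A below by metis
qed

theorem theorem2:
  fixes a :: "'u::{real_inner, complete_space} \<Rightarrow> 'v::{real_inner, complete_space} \<Rightarrow> real"
    and l :: "'v \<Rightarrow> real"
    and \<mu> \<alpha> :: real
    and M :: "'x::euclidean_space measure"
    and F :: "('x \<Rightarrow> 'y::euclidean_space) set"
    and cls :: "('x \<Rightarrow> 'y) \<Rightarrow> 'u"
    and \<sigma> :: "real \<Rightarrow> real"
    and n :: "nat \<Rightarrow> nat"
    and L :: nat
    and \<theta> :: "'s::euclidean_space"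
    and VM :: "'v set"
    and u :: 'u
    and u\<theta> :: "'x \<Rightarrow> 'y"
    and \<phi> :: 'v
  assumes "bounded_linear l"
    and "bilinear a"
    and "\<mu> > 0" and "\<alpha> > 0"
    and "\<And>w v. a w v \<le> \<mu> * norm w * norm v"
    and "\<And>w. (SUP v\<in>{v. v \<noteq> 0}. a w v / norm v) \<ge> \<alpha> * norm w"
    and "\<And>v. (\<And>w. a w v = 0) \<Longrightarrow> v = 0"
    and "hilbert_function_space M F cls"
    and "\<not> linear \<sigma>"
    and "L \<ge> 1" and "\<And>k. k \<le> L \<Longrightarrow> n k \<ge> 1"
    and "n 0 = DIM('x)" and "n L = DIM('y)" and "num_params n L = DIM('s)"
    and "\<And>v. a u v = l v"
    and "u\<theta> = network \<sigma> n L \<theta>"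
    and "u\<theta> \<in> network_space TYPE('s) \<sigma> n L F"
    and "subspace VM" and "\<exists>B. finite B \<and> VM = span B"
    and "\<phi> \<in> VM"
    and "\<And>v. v \<in> VM \<Longrightarrow> \<phi> \<bullet> v = l v - a (cls u\<theta>) v"
  shows "1 / \<mu> * norm \<phi> \<le> quotient_norm (coset_of (left_annihilator a VM) (u - cls u\<theta>)) \<and>
         quotient_norm (coset_of (left_annihilator a VM) (u - cls u\<theta>)) \<le> 1 / \<alpha> * norm \<phi>"
proof -
  define N where "N = left_annihilator a VM"
  define e where "e = u - cls u\<theta>"
  note bil = \<open>bilinear a\<close>
  note bound = \<open>\<And>w v. a w v \<le> \<mu> * norm w * norm v\<close>
  have res: "a e v = \<phi> \<bullet> v" if "v \<in> VM" for v
    using that assms by (simp add: e_def bilinear_lsub[OF bil])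
  have zero_mem: "0 \<in> N" by (simp add: N_def left_annihilator_def bilinear_lzero[OF bil])
  have lower: "norm \<phi> / \<mu> \<le> norm (e + w0)" if "w0 \<in> N" for w0
  proof (cases "\<phi> = 0")
    \<comment> \<open>Here \<open>norm \<phi>\<close> can be cancelled. Since \<open>\<phi>\<close>
      is in \<open>VM\<close>, it is an admissible test vector and \<open>w0\<close> contributes
      nothing.\<close>
    case False
    have "a (e + w0) \<phi> = \<phi> \<bullet> \<phi>"
      using that \<open>\<phi> \<in> VM\<close> res by (simp add: N_def left_annihilator_def bilinear_ladd[OF bil])
    then have "norm \<phi> * norm \<phi> \<le> (\<mu> * norm (e + w0)) * norm \<phi>"
      using bound[of "e + w0" \<phi>] by (simp flip: power2_norm_eq_inner power2_eq_square)
    then have "norm \<phi> \<le> \<mu> * norm (e + w0)" using False by simp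
    then show ?thesis using \<open>\<mu> > 0\<close> by (simp add: pos_divide_le_eq mult.commute)
  qed simp
  \<comment> \<open>The functional \<open>\<phi> \<bullet> v\<close> is defined on all of
    \<open>'v\<close>, so the problem is solved against the whole space, where the constant
    \<open>\<alpha>\<close> is available.\<close>
  obtain w where w: "\<And>v. a w v = \<phi> \<bullet> v" and w_le: "\<alpha> * norm w \<le> norm \<phi>"
    using babuska_lax_milgram[OF bil \<open>\<mu> > 0\<close> \<open>\<alpha> > 0\<close> bound assms(6,7), where \<phi> = \<phi>] by blast
  have "w - e \<in> N" by (simp add: N_def left_annihilator_def bilinear_lsub[OF bil] w res)
  \<comment> \<open>The competitor \<open>w - e\<close> turns \<open>e + w0\<close> into
    \<open>w\<close>, whose norm is already controlled.\<close>
  then have "(INF w0\<in>N. norm (e + w0)) \<le> norm (e + (w - e))"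
    by (intro cINF_lower bdd_belowI[of _ 0]) auto
  also have "\<dots> \<le> norm \<phi> / \<alpha>"
    using w_le \<open>\<alpha> > 0\<close> by (simp add: pos_le_divide_eq mult.commute)
  finally have upper: "(INF w0\<in>N. norm (e + w0)) \<le> norm \<phi> / \<alpha>" .
  have "norm \<phi> / \<mu> \<le> (INF w0\<in>N. norm (e + w0))"
    using zero_mem lower by (intro cINF_greatest) auto
  then show ?thesis using upper by (simp add: quotient_norm_coset_of flip: N_def e_def)
qed

end
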